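(* Let $\mathcal{O}$ be a local principal ideal ring, complete with respect to its maximal ideal $\mathfrak{m}=(\pi)$, with residue field $k=\mathcal{O}/\mathfrak{m}$ of characteristic $\neq 2$, and let $m\geq 1$ be a positive integer. Then the $(m+1)$-th Engel map $e_{m+1}^{\mathcal{O}}\colon \mathfrak{sl}_2^{\circ}(\mathcal{O})\times \mathfrak{sl}_2^{\circ}(\mathcal{O})\to \mathfrak{sl}_2^{\circ}(\mathcal{O})$ is surjective if and only if the $(m+1)$-th Engel map $\bar e_{m+1}\colon \mathfrak{sl}_2(k)\times \mathfrak{sl}_2(k)\to \mathfrak{sl}_2(k)$ is surjective.
   Context: Rings are commutative with unity. $\mathcal{O}$ is complete with respect to $\mathfrak{m}$ if the canonical map $\mathcal{O}\to\varprojlim_{j\ge 1}\mathcal{O}/\mathfrak{m}^j$ is an isomorphism. For a commutative ring $\mathcal{R}$ with unity, the Engel maps on $2\times 2$ matrices over $\mathcal{R}$ are defined by $e_1^{\mathcal{R}}(X,Y)=XY-YX$ and $e_{r+1}^{\mathcal{R}}(X,Y)=e_r^{\mathcal{R}}(X,Y)\,Y-Y\,e_r^{\mathcal{R}}(X,Y)$ for $r\ge 1$; write $\bar e_r=e_r^{k}$. Here $\mathfrak{sl}_2^{\circ}(\mathcal{O})=\{A\in \mathrm{M}_2(\mathcal{O})\mid \mathrm{tr}(A)=0\}$ and $\mathfrak{sl}_2(k)=\{A\in \mathrm{M}_2(k)\mid \mathrm{tr}(A)=0\}$, and the maps in the claim are the restrictions of the Engel maps to pairs of trace-zero matrices. 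*)

theory Defs
  imports "HOL-Algebra.Algebra" "HOL-Analysis.Finite_Cartesian_Product"
begin

section \<open>Rings\<close>

definition local_ring :: "('a, 'b) ring_scheme \<Rightarrow> bool" where
  "local_ring R \<longleftrightarrow> cring R \<and> (\<exists>!M. maximalideal M R)"

text \<open>Zero divisors are allowed, so this is weaker than \<^locale>\<open>principal_domain\<close>.\<close>

definition principal_ideal_ring :: "('a, 'b) ring_scheme \<Rightarrow> bool" where
  "principal_ideal_ring R \<longleftrightarrow> cring R \<and> (\<forall>I. ideal I R \<longrightarrow> principalideal I R)"

text \<open>The order of \<open>\<one>\<close> in the additive group; \<^const>\<open>group.ord\<close> is \<open>0\<close> on elements of infinite order.\<close>

definition ring_char :: "('a, 'b) ring_scheme \<Rightarrow> nat" where
  "ring_char R = group.ord (add_monoid R) \<one>\<^bsub>R\<^esub>"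

abbreviation ideal_power :: "('a, 'b) ring_scheme \<Rightarrow> 'a set \<Rightarrow> nat \<Rightarrow> 'a set" where
  "ideal_power R I j \<equiv> I [^]\<^bsub>ideals_set R\<^esub> j"

text \<open>
  The inverse limit of the rings \<open>R / I^j\<close> for \<open>j \<ge> 1\<close>, as the subring of compatible families in
  their product. For \<open>i \<le> j\<close> the transition map \<open>R / I^j \<rightarrow> R / I^i\<close> sends a coset \<open>C\<close> of \<open>I^j\<close>
  to \<open>I^i + C\<close>, which is the coset of \<open>I^i\<close> containing \<open>C\<close>.
\<close>

definition adic_limit :: "('a, 'b) ring_scheme \<Rightarrow> 'a set \<Rightarrow> (nat \<Rightarrow> 'a set) ring" where
  "adic_limit R I =
    \<lparr> carrier = {f \<in> (\<Pi>\<^sub>E j\<in>{1..}. carrier (R Quot ideal_power R I j)).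
                   \<forall>i j. 1 \<le> i \<longrightarrow> i \<le> j \<longrightarrow> f i = ideal_power R I i <+>\<^bsub>R\<^esub> f j},
      monoid.mult = (\<lambda>f g. \<lambda>j\<in>{1..}. f j \<otimes>\<^bsub>R Quot ideal_power R I j\<^esub> g j),
      one = (\<lambda>j\<in>{1..}. \<one>\<^bsub>R Quot ideal_power R I j\<^esub>),
      ring.zero = (\<lambda>j\<in>{1..}. \<zero>\<^bsub>R Quot ideal_power R I j\<^esub>),
      add = (\<lambda>f g. \<lambda>j\<in>{1..}. f j \<oplus>\<^bsub>R Quot ideal_power R I j\<^esub> g j) \<rparr>"

definition adic_map :: "('a, 'b) ring_scheme \<Rightarrow> 'a set \<Rightarrow> 'a \<Rightarrow> nat \<Rightarrow> 'a set" where
  "adic_map R I a = (\<lambda>j\<in>{1..}. ideal_power R I j +>\<^bsub>R\<^esub> a)"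

definition adically_complete :: "('a, 'b) ring_scheme \<Rightarrow> 'a set \<Rightarrow> bool" where
  "adically_complete R I \<longleftrightarrow> adic_map R I \<in> ring_iso R (adic_limit R I)"


section \<open>Matrices and Engel maps\<close>

text \<open>
  The type of entries carries no algebraic structure of its own: the operations are those of \<open>R\<close>,
  and the matrices over \<open>R\<close> are those with all entries in \<open>carrier R\<close>.
\<close>

definition mat2 :: "('a, 'b) ring_scheme \<Rightarrow> ('a^2^2) set" where
  "mat2 R = {A. \<forall>i j. A $ i $ j \<in> carrier R}"

definition mat2_mult :: "('a, 'b) ring_scheme \<Rightarrow> 'a^2^2 \<Rightarrow> 'a^2^2 \<Rightarrow> 'a^2^2" where
  "mat2_mult R A B = (\<chi> i j. \<Oplus>\<^bsub>R\<^esub>l\<in>UNIV. A $ i $ l \<otimes>\<^bsub>R\<^esub> B $ l $ j)"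

definition mat2_minus :: "('a, 'b) ring_scheme \<Rightarrow> 'a^2^2 \<Rightarrow> 'a^2^2 \<Rightarrow> 'a^2^2" where
  "mat2_minus R A B = (\<chi> i j. A $ i $ j \<ominus>\<^bsub>R\<^esub> B $ i $ j)"

definition mat2_trace :: "('a, 'b) ring_scheme \<Rightarrow> 'a^2^2 \<Rightarrow> 'a" where
  "mat2_trace R A = (\<Oplus>\<^bsub>R\<^esub>i\<in>UNIV. A $ i $ i)"

definition sl2 :: "('a, 'b) ring_scheme \<Rightarrow> ('a^2^2) set" where
  "sl2 R = {A \<in> mat2 R. mat2_trace R A = \<zero>\<^bsub>R\<^esub>}"

text \<open>
  The recursion is started at \<open>e\<^sub>0(A, B) = A\<close>, so that its first step gives \<open>e\<^sub>1(A, B) = AB - BA\<close>.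
\<close>

primrec engel :: "('a, 'b) ring_scheme \<Rightarrow> nat \<Rightarrow> 'a^2^2 \<Rightarrow> 'a^2^2 \<Rightarrow> 'a^2^2" where
  "engel R 0 A B = A"
| "engel R (Suc r) A B =
    mat2_minus R (mat2_mult R (engel R r A B) B) (mat2_mult R B (engel R r A B))"

definition engel_surj_sl2 :: "('a, 'b) ring_scheme \<Rightarrow> nat \<Rightarrow> bool" where
  "engel_surj_sl2 R r \<longleftrightarrow> (\<lambda>(A, B). engel R r A B) ` (sl2 R \<times> sl2 R) = sl2 R"

end

theory Submission
  imports Defs "HOL-Analysis.Cartesian_Space"
begin

text \<open>
  Both sides of the equivalence always hold. If \<open>Y\<close> is trace-zero with \<open>Y\<^sup>2 = \<delta>\<close> for a unit \<open>\<delta>\<close> and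
  \<open>tr(CY) = 0\<close>, then \<open>e\<^sub>2(C, Y) = 4\<delta>C\<close>; since \<open>e\<^sub>2\<^sub>r(C, Y) = e\<^sub>r(e\<^sub>r(C, Y), Y)\<close> and \<open>2\<close> is a unit, \<open>C\<close>
  lies in the image of \<open>X \<mapsto> e\<^sub>r(X, Y)\<close> for every \<open>r\<close>. In a local principal ideal ring
  divisibility is a total order, so every trace-zero matrix is \<open>gC\<close> with some entry of \<open>C\<close> equal
  to \<open>1\<close>. For such a \<open>C\<close> a suitable \<open>Y\<close> can be written down, and by linearity in the first argument
  \<open>gC\<close> is attained as well. This applies to \<open>R\<close> and, as a field is a local principal ideal ring,
  to \<open>R/M\<close>.
\<close>

section \<open>Engel maps on trace-zero matrices\<close>

definition sl2_mat :: "('a, 'b) ring_scheme \<Rightarrow> 'a \<Rightarrow> 'a \<Rightarrow> 'a \<Rightarrow> 'a^2^2" where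
  "sl2_mat R a b c =
    (\<chi> i j. if i = 1 then (if j = 1 then a else b) else (if j = 1 then c else \<ominus>\<^bsub>R\<^esub> a))"

definition mat2_smult :: "('a, 'b) ring_scheme \<Rightarrow> 'a \<Rightarrow> 'a^2^2 \<Rightarrow> 'a^2^2" where
  "mat2_smult R g A = (\<chi> i j. g \<otimes>\<^bsub>R\<^esub> A $ i $ j)"

section \<open>Trace-zero matrices in coordinates and their brackets\<close>

context cring
begin

lemma finsum_2:
  assumes "f (1::2) \<in> carrier R" "f 2 \<in> carrier R"
  shows "(\<Oplus>i\<in>UNIV. f i) = f 1 \<oplus> f 2"
  using assms by (simp add: UNIV_2 finsum_insert Pi_def)

lemma sl2_mat_mem:
  assumes "a \<in> carrier R" "b \<in> carrier R" "c \<in> carrier R"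
  shows "sl2_mat R a b c \<in> sl2 R"
  using assms by (simp add: sl2_def mat2_def sl2_mat_def mat2_trace_def finsum_2 r_neg)

lemma sl2E:
  assumes "A \<in> sl2 R"
  obtains a b c where "a \<in> carrier R" "b \<in> carrier R" "c \<in> carrier R" "A = sl2_mat R a b c"
proof -
  have car: "A $ i $ j \<in> carrier R" for i j
    using assms by (simp add: sl2_def mat2_def)
  have "A $ 1 $ 1 \<oplus> A $ 2 $ 2 = \<zero>"
    using assms car by (simp add: sl2_def mat2_trace_def finsum_2)
  then have "A $ 2 $ 2 = \<ominus> (A $ 1 $ 1)"
    using car by (metis a_comm minus_equality)
  then have "A = sl2_mat R (A $ 1 $ 1) (A $ 1 $ 2) (A $ 2 $ 1)"
    by (simp add: sl2_mat_def vec_eq_iff forall_2)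
  with car that show thesis by blast
qed

text \<open>The three expressions are the components of the cross product of
  \<open>(a, b, c)\<close> and \<open>(x, y, z)\<close>, the two off-diagonal ones doubled. Every
  later bracket is computed in these coordinates.\<close>

lemma sl2_mat_commutator:
  assumes [simp]: "a \<in> carrier R" "b \<in> carrier R" "c \<in> carrier R"
    "x \<in> carrier R" "y \<in> carrier R" "z \<in> carrier R"
  shows "mat2_minus R (mat2_mult R (sl2_mat R a b c) (sl2_mat R x y z))
                      (mat2_mult R (sl2_mat R x y z) (sl2_mat R a b c)) =
    sl2_mat R (b \<otimes> z \<ominus> c \<otimes> y) ((a \<otimes> y \<ominus> b \<otimes> x) \<oplus> (a \<otimes> y \<ominus> b \<otimes> x))
      ((c \<otimes> x \<ominus> a \<otimes> z) \<oplus> (c \<otimes> x \<ominus> a \<otimes> z))"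
proof -
  \<comment> \<open>The entries 11, 12, 21, 22 as matrix multiplication leaves them. The last is the
    negative of the first, so the bracket again has the shape \<open>sl2_mat\<close>.\<close>
  have "a \<otimes> x \<oplus> b \<otimes> z \<ominus> (x \<otimes> a \<oplus> y \<otimes> c) = b \<otimes> z \<ominus> c \<otimes> y"
    "a \<otimes> y \<oplus> b \<otimes> (\<ominus> x) \<ominus> (x \<otimes> b \<oplus> y \<otimes> (\<ominus> a)) = (a \<otimes> y \<ominus> b \<otimes> x) \<oplus> (a \<otimes> y \<ominus> b \<otimes> x)"
    "c \<otimes> x \<oplus> (\<ominus> a) \<otimes> z \<ominus> (z \<otimes> a \<oplus> (\<ominus> x) \<otimes> c) = (c \<otimes> x \<ominus> a \<otimes> z) \<oplus> (c \<otimes> x \<ominus> a \<otimes> z)"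
    "c \<otimes> y \<oplus> (\<ominus> a) \<otimes> (\<ominus> x) \<ominus> (z \<otimes> b \<oplus> (\<ominus> x) \<otimes> (\<ominus> a)) = \<ominus> (b \<otimes> z \<ominus> c \<otimes> y)"
    using assms by algebra+
  then show ?thesis
    by (simp add: vec_eq_iff forall_2 mat2_minus_def mat2_mult_def sl2_mat_def finsum_2)
qed

lemma mat2_smult_sl2_mat:
  assumes "a \<in> carrier R" "g \<in> carrier R"
  shows "mat2_smult R g (sl2_mat R a b c) = sl2_mat R (g \<otimes> a) (g \<otimes> b) (g \<otimes> c)"
  using assms by (simp add: vec_eq_iff forall_2 mat2_smult_def sl2_mat_def r_minus)

lemma mat2_smult_mem_sl2: "g \<in> carrier R \<Longrightarrow> A \<in> sl2 R \<Longrightarrow> mat2_smult R g A \<in> sl2 R"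
  by (metis m_closed mat2_smult_sl2_mat sl2E sl2_mat_mem)

lemma mat2_smult_smult:
  assumes "g \<in> carrier R" "h \<in> carrier R" "A \<in> sl2 R"
  shows "mat2_smult R g (mat2_smult R h A) = mat2_smult R (g \<otimes> h) A"
  using assms by (simp add: vec_eq_iff mat2_smult_def sl2_def mat2_def m_assoc)

lemma mat2_smult_one: "A \<in> sl2 R \<Longrightarrow> mat2_smult R \<one> A = A"
  by (simp add: vec_eq_iff mat2_smult_def sl2_def mat2_def)

section \<open>Engel maps as iterated brackets\<close>

lemma engel_mem_sl2:
  assumes "A \<in> sl2 R" "B \<in> sl2 R"
  shows "engel R r A B \<in> sl2 R"
proof (induction r)
  case (Suc r)
  obtain a b c x y z where "a \<in> carrier R" "b \<in> carrier R" "c \<in> carrier R"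
    "x \<in> carrier R" "y \<in> carrier R" "z \<in> carrier R"
    "engel R r A B = sl2_mat R a b c" "B = sl2_mat R x y z"
    using Suc assms(2) by (metis sl2E)
  then show ?case
    by (simp add: sl2_mat_commutator sl2_mat_mem)
qed (use assms in simp)

text \<open>Bracketing with a fixed \<open>B\<close> is linear in the other argument, so a scalar
  passes through every step. This serves both to rescale a preimage and to pull a common factor out
  of a target.\<close>

lemma engel_smult:
  assumes "A \<in> sl2 R" "B \<in> sl2 R" "g \<in> carrier R"
  shows "engel R r (mat2_smult R g A) B = mat2_smult R g (engel R r A B)"
proof (induction r)
  case (Suc r)
  obtain a b c x y z where [simp]: "a \<in> carrier R" "b \<in> carrier R" "c \<in> carrier R"
    "x \<in> carrier R" "y \<in> carrier R" "z \<in> carrier R"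
    and B: "B = sl2_mat R x y z" and E: "engel R r A (sl2_mat R x y z) = sl2_mat R a b c"
    using engel_mem_sl2[OF assms(1,2)] assms(2) by (metis sl2E)
  have "(g \<otimes> b) \<otimes> z \<ominus> (g \<otimes> c) \<otimes> y = g \<otimes> (b \<otimes> z \<ominus> c \<otimes> y)"
    "((g \<otimes> a) \<otimes> y \<ominus> (g \<otimes> b) \<otimes> x) \<oplus> ((g \<otimes> a) \<otimes> y \<ominus> (g \<otimes> b) \<otimes> x)
      = g \<otimes> ((a \<otimes> y \<ominus> b \<otimes> x) \<oplus> (a \<otimes> y \<ominus> b \<otimes> x))"
    "((g \<otimes> c) \<otimes> x \<ominus> (g \<otimes> a) \<otimes> z) \<oplus> ((g \<otimes> c) \<otimes> x \<ominus> (g \<otimes> a) \<otimes> z)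
      = g \<otimes> ((c \<otimes> x \<ominus> a \<otimes> z) \<oplus> (c \<otimes> x \<ominus> a \<otimes> z))"
    using assms(3) by (simp_all add: r_distr r_minus minus_eq m_assoc)
  then show ?case
    using Suc assms(3) by (simp add: B E mat2_smult_sl2_mat sl2_mat_commutator)
qed simp

text \<open>\<open>B\<close> stays fixed, so \<open>engel R r\<close> is the r-fold iterate of a
  single map; starting the recursion at index 0 makes the indices add without a shift.\<close>

lemma engel_add: "engel R (r + s) A B = engel R s (engel R r A B) B"
  by (induction s) simp_all

text \<open>
  If \<open>tr(CY) = 0\<close>, then \<open>C\<close> anticommutes with \<open>Y\<close>, while \<open>Y\<^sup>2\<close> is the scalar \<open>x\<^sup>2 + yz\<close>.
\<close>

lemma engel_2_orthogonal:
  assumes car [simp]: "a \<in> carrier R" "b \<in> carrier R" "c \<in> carrier R"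
    "x \<in> carrier R" "y \<in> carrier R" "z \<in> carrier R"
    and orth: "a \<otimes> x \<oplus> a \<otimes> x \<oplus> b \<otimes> z \<oplus> c \<otimes> y = \<zero>"
    and d: "d = x \<otimes> x \<oplus> y \<otimes> z"
  shows "engel R 2 (sl2_mat R a b c) (sl2_mat R x y z) =
    mat2_smult R ((d \<oplus> d) \<oplus> (d \<oplus> d)) (sl2_mat R a b c)"
proof -
  \<comment> \<open>\<open>orth\<close> is tr(CY) = 0, solved for each of the three partial sums
    that occur below.\<close>
  have orth':
    "b \<otimes> z \<oplus> c \<otimes> y = \<ominus> (a \<otimes> x \<oplus> a \<otimes> x)"
    "a \<otimes> x \<oplus> a \<otimes> x \<oplus> c \<otimes> y = \<ominus> (b \<otimes> z)"
    "a \<otimes> x \<oplus> a \<otimes> x \<oplus> b \<otimes> z = \<ominus> (c \<otimes> y)"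
    by (rule minus_equality[symmetric], use orth in \<open>simp_all add: a_ac\<close>)+
  \<comment> \<open>The first bracket has coordinates \<open>p\<close>, \<open>2q\<close>,
    \<open>2r\<close>. Half of each coordinate of the second bracket is computed next: it is
    rewritten until the left side of one equation of \<open>orth'\<close> appears as a factor, and
    after substitution a polynomial identity remains. Hence \<open>2d\<close> in \<open>1\<close>,
    \<open>2\<close>, \<open>3\<close> and \<open>4d\<close> in the end.\<close>
  define p q r where "p = b \<otimes> z \<ominus> c \<otimes> y" and "q = a \<otimes> y \<ominus> b \<otimes> x" and "r = c \<otimes> x \<ominus> a \<otimes> z"
  have pqr [simp]: "p \<in> carrier R" "q \<in> carrier R" "r \<in> carrier R"
    by (simp_all add: p_def q_def r_def)
  have "q \<otimes> z \<ominus> r \<otimes> y = a \<otimes> y \<otimes> z \<oplus> a \<otimes> y \<otimes> z \<ominus> x \<otimes> (b \<otimes> z \<oplus> c \<otimes> y)"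
    unfolding q_def r_def using car by algebra
  then have 1: "q \<otimes> z \<ominus> r \<otimes> y = (d \<oplus> d) \<otimes> a"
    unfolding orth' d using car by algebra
  have "p \<otimes> y \<ominus> (q \<oplus> q) \<otimes> x =
      b \<otimes> z \<otimes> y \<oplus> b \<otimes> x \<otimes> x \<oplus> b \<otimes> x \<otimes> x \<ominus> y \<otimes> (a \<otimes> x \<oplus> a \<otimes> x \<oplus> c \<otimes> y)"
    unfolding p_def q_def using car by algebra
  then have 2: "p \<otimes> y \<ominus> (q \<oplus> q) \<otimes> x = (d \<oplus> d) \<otimes> b"
    unfolding orth' d using car by algebra
  have "(r \<oplus> r) \<otimes> x \<ominus> p \<otimes> z =
      c \<otimes> x \<otimes> x \<oplus> c \<otimes> x \<otimes> x \<oplus> c \<otimes> y \<otimes> z \<ominus> z \<otimes> (a \<otimes> x \<oplus> a \<otimes> x \<oplus> b \<otimes> z)"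
    unfolding p_def r_def using car by algebra
  then have 3: "(r \<oplus> r) \<otimes> x \<ominus> p \<otimes> z = (d \<oplus> d) \<otimes> c"
    unfolding orth' d using car by algebra
  have dc [simp]: "d \<in> carrier R" by (simp add: d)
  have "(q \<oplus> q) \<otimes> z \<ominus> (r \<oplus> r) \<otimes> y = (q \<otimes> z \<ominus> r \<otimes> y) \<oplus> (q \<otimes> z \<ominus> r \<otimes> y)"
    using pqr car by algebra
  then have "(q \<oplus> q) \<otimes> z \<ominus> (r \<oplus> r) \<otimes> y = (d \<oplus> d \<oplus> (d \<oplus> d)) \<otimes> a"
    unfolding 1 by (simp add: l_distr)
  moreover have "(p \<otimes> y \<ominus> (q \<oplus> q) \<otimes> x) \<oplus> (p \<otimes> y \<ominus> (q \<oplus> q) \<otimes> x) = (d \<oplus> d \<oplus> (d \<oplus> d)) \<otimes> b"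
    unfolding 2 by (simp add: l_distr)
  moreover have "((r \<oplus> r) \<otimes> x \<ominus> p \<otimes> z) \<oplus> ((r \<oplus> r) \<otimes> x \<ominus> p \<otimes> z) = (d \<oplus> d \<oplus> (d \<oplus> d)) \<otimes> c"
    unfolding 3 by (simp add: l_distr)
  ultimately show ?thesis
    by (simp add: numeral_2_eq_2 sl2_mat_commutator mat2_smult_sl2_mat flip: p_def q_def r_def)
qed

text \<open>\<open>C\<close> is an eigenvector of the double bracket with eigenvalue
  \<open>e\<close>, so \<open>r\<close> double brackets scale it by the r-th power.\<close>

lemma engel_even_orthogonal:
  assumes CY: "C \<in> sl2 R" "Y \<in> sl2 R" and e: "e \<in> carrier R"
    and "engel R 2 C Y = mat2_smult R e C"
  shows "engel R (2 * r) C Y = mat2_smult R (e [^] r) C"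
proof (induction r)
  case 0
  then show ?case using CY by (simp add: mat2_smult_one)
next
  case (Suc r)
  have "engel R (2 * Suc r) C Y = engel R (2 * r) (engel R 2 C Y) Y"
    using engel_add[of 2 "2 * r"] by simp
  also have "\<dots> = mat2_smult R (e [^] Suc r) C"
    using assms Suc by (simp add: engel_smult mat2_smult_smult m_comm)
  finally show ?case .
qed

lemma engel_surj_at_orthogonal:
  assumes car [simp]: "a \<in> carrier R" "b \<in> carrier R" "c \<in> carrier R"
    "x \<in> carrier R" "y \<in> carrier R" "z \<in> carrier R"
    and orth: "a \<otimes> x \<oplus> a \<otimes> x \<oplus> b \<otimes> z \<oplus> c \<otimes> y = \<zero>"
    and d: "x \<otimes> x \<oplus> y \<otimes> z \<in> Units R"
    and two: "\<one> \<oplus> \<one> \<in> Units R"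
  shows "\<exists>A \<in> sl2 R. engel R r A (sl2_mat R x y z) = sl2_mat R a b c"
proof -
  define C Y where "C = sl2_mat R a b c" and "Y = sl2_mat R x y z"
  have CY: "C \<in> sl2 R" "Y \<in> sl2 R"
    by (simp_all add: C_def Y_def sl2_mat_mem)
  define d where "d = x \<otimes> x \<oplus> y \<otimes> z"
  \<comment> \<open>\<open>e\<close> is 4d, the eigenvalue of the double bracket, and a unit because
    2 and \<open>d\<close> are.\<close>
  define e where "e = (d \<oplus> d) \<oplus> (d \<oplus> d)"
  have [simp]: "d \<in> carrier R" "e \<in> carrier R" by (simp_all add: d_def e_def)
  have "e = (\<one> \<oplus> \<one>) \<otimes> (\<one> \<oplus> \<one>) \<otimes> d"
    by (simp add: e_def l_distr r_distr)
  then have "e \<in> Units R"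
    using two d by (simp add: d_def Units_m_closed)
  then have u: "e [^] r \<in> Units R" by (rule Units_pow_closed)
  \<comment> \<open>Applying \<open>engel R r\<close> to \<open>engel R r C Y\<close> gives index
    \<open>2 * r\<close>, which is even whatever the parity of \<open>r\<close>; the inverse cancels
    the resulting scalar.\<close>
  define A where "A = mat2_smult R (inv (e [^] r)) (engel R r C Y)"
  have E: "engel R r C Y \<in> sl2 R" using CY by (rule engel_mem_sl2)
  have "engel R r A Y = mat2_smult R (inv (e [^] r)) (engel R (2 * r) C Y)"
    using E CY u by (simp add: A_def engel_smult mult_2 engel_add)
  also have "engel R (2 * r) C Y = mat2_smult R (e [^] r) C"
    using engel_2_orthogonal[OF car orth] CY
    by (intro engel_even_orthogonal) (simp_all add: C_def Y_def e_def d_def)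
  also have "mat2_smult R (inv (e [^] r)) \<dots> = C"
    using CY u by (simp add: mat2_smult_smult mat2_smult_one)
  finally show ?thesis
    using E u by (auto simp: C_def Y_def A_def intro!: mat2_smult_mem_sl2)
qed

end

section \<open>Local principal ideal rings\<close>

context cring
begin

text \<open>Zorn's lemma for the ideals that contain \<open>x\<close> but not \<open>\<one>\<close>.
  A maximal member is a maximal ideal: an ideal above it either contains \<open>\<one>\<close> and
  is the whole ring, or belongs to the same family.\<close>

lemma nonunit_in_maximalideal:
  assumes "x \<in> carrier R" "x \<notin> Units R"
  obtains J where "maximalideal J R" "x \<in> J"
proof -
  let ?A = "{I. ideal I R \<and> x \<in> I \<and> \<one> \<notin> I}"
  have "\<one> \<notin> PIdl x"
    using assms ideal_eq_carrier_iff ideal.one_imp_carrier[OF cgenideal_ideal] by metis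
  then have "PIdl x \<in> ?A"
    using assms by (simp add: cgenideal_ideal cgenideal_self)
  then have ne: "?A \<noteq> {}" by blast
  have ch: "\<Union>C \<in> ?A" if C: "C \<noteq> {}" "subset.chain ?A C" for C
  proof -
    have "subset.chain {I. ideal I R} C"
      using C by (auto simp: subset_chain_def)
    then have "ideal (\<Union>C) R"
      using chain_Union_is_ideal[of C] C by auto
    then show ?thesis
      using C by (auto simp: subset_chain_def)
  qed
  obtain J where "J \<in> ?A" and Jmax: "\<forall>I \<in> ?A. J \<subseteq> I \<longrightarrow> I = J"
    using subset_Zorn_nonempty[OF ne ch] by (rule bexE)
  then have J: "ideal J R" "x \<in> J" "\<one> \<notin> J" by simp_all
  have "maximalideal J R"
  proof (rule maximalidealI)
    show "carrier R \<noteq> J" using J by auto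
    show "I = J \<or> I = carrier R" if "ideal I R" "J \<subseteq> I" for I
    proof (cases "\<one> \<in> I")
      case True
      then show ?thesis using that ideal.one_imp_carrier by metis
    next
      case False
      then show ?thesis using that J Jmax by auto
    qed
  qed (rule J)
  then show thesis using J that by simp
qed

lemma local_nonunit_mem:
  assumes "local_ring R" "maximalideal M R" "x \<in> carrier R" "x \<notin> Units R"
  shows "x \<in> M"
  using nonunit_in_maximalideal[OF assms(3,4)] assms(1,2) unfolding local_ring_def by metis

text \<open>Two nonunits both lie in the unique maximal ideal, which cannot contain their sum if
  that sum is 1.\<close>

lemma local_unit_or_complement:
  assumes "local_ring R" "x \<in> carrier R"
  shows "x \<in> Units R \<or> \<one> \<ominus> x \<in> Units R"
proof (rule ccontr)
  assume non: "\<not> ?thesis"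
  obtain M where M: "maximalideal M R" using assms(1) by (auto simp: local_ring_def)
  interpret maximalideal M R by fact
  have "x \<in> M" "\<one> \<ominus> x \<in> M"
    using non local_nonunit_mem[OF assms(1) M] assms(2) by simp_all
  then have "(\<one> \<ominus> x) \<oplus> x \<in> M" by blast
  moreover have "(\<one> \<ominus> x) \<oplus> x = \<one>" using assms(2) by algebra
  ultimately show False using one_imp_carrier I_notcarr by simp
qed

end

text \<open>Locality is stated on elements, the form that the divisibility argument uses and that is
  immediate for a field; the locale thus covers both the given ring and its residue field.\<close>

locale local_principal_ring = cring +
  assumes unit_or_complement: "x \<in> carrier R \<Longrightarrow> x \<in> Units R \<or> \<one> \<ominus> x \<in> Units R"
    and principal: "ideal I R \<Longrightarrow> principalideal I R"
begin

text \<open>Dividing by the unit \<open>x \<oplus> y\<close> reduces to two elements with sum 1. In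
  contrapositive form, nonunits are closed under addition.\<close>

lemma Units_of_sum:
  assumes [simp]: "x \<in> carrier R" "y \<in> carrier R" and "x \<oplus> y \<in> Units R"
  shows "x \<in> Units R \<or> y \<in> Units R"
proof -
  define u where "u = inv (x \<oplus> y)"
  have [simp]: "u \<in> carrier R" using assms by (simp add: u_def)
  have "u \<otimes> x \<oplus> u \<otimes> y = \<one>"
    using assms by (simp add: u_def flip: r_distr)
  then have "\<one> \<ominus> u \<otimes> x = u \<otimes> y"
    by (metis \<open>u \<in> carrier R\<close> add.inv_solve_right' assms(1,2) a_comm m_closed minus_eq one_closed)
  then have "u \<otimes> x \<in> Units R \<or> u \<otimes> y \<in> Units R"
    using unit_or_complement[of "u \<otimes> x"] by auto
  then show ?thesis
    using unit_factor m_comm by (metis \<open>u \<in> carrier R\<close> assms(1,2))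
qed

text \<open>The ideal generated by \<open>a\<close> and \<open>b\<close> has a single generator
  \<open>g\<close>. Locality forces \<open>g\<close> to be a unit multiple of \<open>a\<close> or of
  \<open>b\<close>, or to vanish.\<close>

lemma divides_linear:
  assumes [simp]: "a \<in> carrier R" "b \<in> carrier R"
  shows "a divides b \<or> b divides a"
proof -
  have id: "ideal (PIdl a <+> PIdl b) R"
    by (simp add: add_ideals cgenideal_ideal)
  obtain g where g [simp]: "g \<in> carrier R" and eq: "PIdl a <+> PIdl b = PIdl g"
    using principalideal.generate[OF principal[OF id]] by (metis cgenideal_eq_genideal)
  have z: "\<zero> \<in> PIdl a" "\<zero> \<in> PIdl b"
    by (simp_all add: additive_subgroup.zero_closed cgenideal_ideal ideal.axioms(1))
  have "a \<oplus> \<zero> \<in> PIdl a <+> PIdl b" "\<zero> \<oplus> b \<in> PIdl a <+> PIdl b"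
    unfolding set_add_def' using z by (blast intro: cgenideal_self assms)+
  then obtain s t where [simp]: "s \<in> carrier R" "t \<in> carrier R" and st: "a = s \<otimes> g" "b = t \<otimes> g"
    unfolding eq by (auto simp: cgenideal_def)
  have "g \<in> PIdl a <+> PIdl b" unfolding eq by (simp add: cgenideal_self)
  then obtain u v where [simp]: "u \<in> carrier R" "v \<in> carrier R" and uv: "g = u \<otimes> a \<oplus> v \<otimes> b"
    unfolding set_add_def' cgenideal_def by auto
  \<comment> \<open>\<open>w\<close> fixes \<open>g\<close>, which does not give
    \<open>w = \<one>\<close> if \<open>g\<close> is a zero divisor. Either \<open>w\<close> is a
    unit, and then so is \<open>s\<close> or \<open>t\<close>, or \<open>\<one> \<ominus> w\<close>
    is a unit that annihilates \<open>g\<close>.\<close>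
  define w where "w = u \<otimes> s \<oplus> v \<otimes> t"
  have [simp]: "w \<in> carrier R" by (simp add: w_def)
  have gw: "g = w \<otimes> g"
    using uv by (simp add: st w_def l_distr m_assoc)
  show ?thesis
  proof (cases "w \<in> Units R")
    case True
    then have "s \<in> Units R \<or> t \<in> Units R"
      using Units_of_sum[of "u \<otimes> s" "v \<otimes> t"] unit_factor[of s u] unit_factor[of t v]
      by (auto simp: w_def m_comm)
    then show ?thesis
    proof
      assume "s \<in> Units R"
      have "a \<otimes> (inv s \<otimes> t) = (s \<otimes> inv s) \<otimes> b"
        unfolding st using \<open>s \<in> Units R\<close> by (simp add: m_ac)
      then have "b = a \<otimes> (inv s \<otimes> t)"
        using \<open>s \<in> Units R\<close> by simp
      then show ?thesis using \<open>s \<in> Units R\<close> by (auto simp: factor_def)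
    next
      assume "t \<in> Units R"
      have "b \<otimes> (inv t \<otimes> s) = (t \<otimes> inv t) \<otimes> a"
        unfolding st using \<open>t \<in> Units R\<close> by (simp add: m_ac)
      then have "a = b \<otimes> (inv t \<otimes> s)"
        using \<open>t \<in> Units R\<close> by simp
      then show ?thesis using \<open>t \<in> Units R\<close> by (auto simp: factor_def)
    qed
  next
    case False
    then have "\<one> \<ominus> w \<in> Units R" using unit_or_complement[of w] by simp
    moreover have "(\<one> \<ominus> w) \<otimes> g = (\<one> \<ominus> w) \<otimes> \<zero>"
      by (simp add: minus_eq l_distr l_minus r_neg flip: gw)
    ultimately have "g = \<zero>"
      using Units_l_cancel[of "\<one> \<ominus> w" g \<zero>] by simp
    then show ?thesis by (simp add: st divides_zero)
  qed
qed

text \<open>The task is to find \<open>Y\<close> orthogonal to the target with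
  \<open>x^2 + yz\<close> a unit. An off-diagonal entry 1 allows \<open>x = 1\<close> and
  \<open>yz = 0\<close>; a diagonal entry 1 requires halving and a case distinction.\<close>

lemma engel_surj_at_one_entry:
  assumes [simp]: "a \<in> carrier R" "b \<in> carrier R" "c \<in> carrier R"
    and one: "a = \<one> \<or> b = \<one> \<or> c = \<one>"
    and two: "\<one> \<oplus> \<one> \<in> Units R"
  shows "\<exists>A \<in> sl2 R. \<exists>Y \<in> sl2 R. engel R r A Y = sl2_mat R a b c"
proof -
  have *: ?thesis if "x \<in> carrier R" "y \<in> carrier R" "z \<in> carrier R"
    "a \<otimes> x \<oplus> a \<otimes> x \<oplus> b \<otimes> z \<oplus> c \<otimes> y = \<zero>" "x \<otimes> x \<oplus> y \<otimes> z \<in> Units R" for x y z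
    using engel_surj_at_orthogonal[of a b c x y z r] that two sl2_mat_mem[of x y z] by auto
  consider "c = \<one>" | "b = \<one>" | "a = \<one>" using one by blast
  then show ?thesis
  proof cases
    case 1
    show ?thesis
      by (rule *[of \<one> "\<ominus> (a \<oplus> a)" \<zero>]) (use 1 in \<open>simp_all add: r_neg\<close>)
  next
    case 2
    show ?thesis
      by (rule *[of \<one> \<zero> "\<ominus> (a \<oplus> a)"]) (use 2 in \<open>simp_all add: r_neg\<close>)
  next
    case 3
    define h where "h = inv (\<one> \<oplus> \<one>)"
    have h [simp]: "h \<in> Units R" "h \<in> carrier R" using two by (simp_all add: h_def)
    have "h \<oplus> h = h \<otimes> (\<one> \<oplus> \<one>)" by (simp add: r_distr)
    then have hh: "h \<oplus> h = \<one>" using two by (simp add: h_def)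
    have dbl: "\<ominus> (h \<otimes> t) \<oplus> \<ominus> (h \<otimes> t) = \<ominus> t" if "t \<in> carrier R" for t
      using that hh by (metis h(2) l_distr l_one m_closed minus_add)
    \<comment> \<open>Orthogonality now reads \<open>2x = -(bz + cy)\<close>. If \<open>c\<close> or
      \<open>b\<close> is a unit, taking one of \<open>y\<close>, \<open>z\<close> to be 1 and the
      other 0 makes \<open>x\<close>, and so \<open>x^2\<close>, a unit.\<close>
    consider "c \<in> Units R" | "b \<in> Units R" | "c \<notin> Units R" "b \<notin> Units R" by blast
    then show ?thesis
    proof cases
      case c: 1
      show ?thesis
        by (rule *[of "\<ominus> (h \<otimes> c)" \<one> \<zero>])
          (use 3 c in \<open>simp_all add: dbl l_neg l_minus r_minus Units_m_closed\<close>)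
    next
      case b: 2
      show ?thesis
        by (rule *[of "\<ominus> (h \<otimes> b)" \<zero> \<one>])
          (use 3 b in \<open>simp_all add: dbl l_neg l_minus r_minus Units_m_closed\<close>)
    next
      case bc: 3
      \<comment> \<open>Here \<open>y = z = 1\<close> forces \<open>2x = -(b + c)\<close>. As
        \<open>b + c\<close> is a nonunit, so is its multiple \<open>-x^2\<close>, and its
        complement \<open>1 + x^2\<close> is a unit.\<close>
      define x where "x = \<ominus> (h \<otimes> (b \<oplus> c))"
      have [simp]: "x \<in> carrier R" by (simp add: x_def)
      have xx: "\<ominus> (x \<otimes> x) = (b \<oplus> c) \<otimes> (h \<otimes> x)"
        by (simp add: x_def l_minus r_minus m_ac)
      have "b \<oplus> c \<notin> Units R"
        using Units_of_sum[of b c] bc by auto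
      then have "\<ominus> (x \<otimes> x) \<notin> Units R"
        unfolding xx using unit_factor[of "b \<oplus> c" "h \<otimes> x"] by auto
      then have "\<one> \<ominus> \<ominus> (x \<otimes> x) \<in> Units R"
        using unit_or_complement[of "\<ominus> (x \<otimes> x)"] by simp
      then have "x \<otimes> x \<oplus> \<one> \<in> Units R" by (simp add: minus_eq a_comm)
      moreover have "x \<oplus> x \<oplus> b \<oplus> c = \<zero>"
        by (simp add: x_def dbl a_assoc l_neg)
      ultimately show ?thesis
        by (intro *[of x \<one> \<one>]) (simp_all add: 3)
    qed
  qed
qed

lemma engel_surj_sl2_local_principal:
  assumes two: "\<one> \<oplus> \<one> \<in> Units R"
  shows "engel_surj_sl2 R r"
proof -
  have "C \<in> (\<lambda>(A, B). engel R r A B) ` (sl2 R \<times> sl2 R)" if C: "C \<in> sl2 R" for C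
  proof -
    obtain a b c where [simp]: "a \<in> carrier R" "b \<in> carrier R" "c \<in> carrier R"
      and C_eq: "C = sl2_mat R a b c"
      using C by (rule sl2E)
    \<comment> \<open>Divisibility is total, so some entry is least among the three and divides the
      others.\<close>
    have "\<exists>g \<in> {a, b, c}. g divides a \<and> g divides b \<and> g divides c"
      using divides_linear[of a b] divides_linear[of b c] divides_linear[of a c]
        divides_refl[of a] divides_refl[of b] divides_refl[of c]
        divides_trans[of a b c] divides_trans[of a c b] divides_trans[of b a c]
        divides_trans[of b c a] divides_trans[of c a b] divides_trans[of c b a]
      by simp blast
    then obtain g s t u where g: "g \<in> {a, b, c}"
      and [simp]: "s \<in> carrier R" "t \<in> carrier R" "u \<in> carrier R"
      and stu: "a = g \<otimes> s" "b = g \<otimes> t" "c = g \<otimes> u"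
      unfolding factor_def by blast
    have [simp]: "g \<in> carrier R" using g by auto
    \<comment> \<open>The cofactor of the entry equal to \<open>g\<close> need not be 1 when
      \<open>g\<close> is a zero divisor, but it can be replaced by 1.\<close>
    obtain s' t' u' where car: "s' \<in> carrier R" "t' \<in> carrier R" "u' \<in> carrier R"
      and eq: "a = g \<otimes> s'" "b = g \<otimes> t'" "c = g \<otimes> u'"
      and one: "s' = \<one> \<or> t' = \<one> \<or> u' = \<one>"
    proof -
      consider "a = g \<otimes> \<one>" | "b = g \<otimes> \<one>" | "c = g \<otimes> \<one>"
        using g by auto
      then show thesis
      proof cases
        case 1
        then show thesis using that[of \<one> t u] stu by simp
      next
        case 2
        then show thesis using that[of s \<one> u] stu by simp
      next
        case 3
        then show thesis using that[of s t \<one>] stu by simp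
      qed
    qed
    obtain A Y where XY: "A \<in> sl2 R" "Y \<in> sl2 R" "engel R r A Y = sl2_mat R s' t' u'"
      using engel_surj_at_one_entry[OF car one two] by blast
    have "engel R r (mat2_smult R g A) Y = C"
      using XY car by (simp add: engel_smult mat2_smult_sl2_mat C_eq eq)
    then show ?thesis
      using XY by (auto intro!: image_eqI[where x = "(mat2_smult R g A, Y)"] mat2_smult_mem_sl2)
  qed
  then show ?thesis
    by (auto simp: engel_surj_sl2_def engel_mem_sl2)
qed

end

section \<open>The residue field and the equivalence\<close>

lemma (in field) local_principal_ring: "local_principal_ring R"
proof (intro local_principal_ring.intro local_principal_ring_axioms.intro is_cring)
  fix x assume "x \<in> carrier R"
  then show "x \<in> Units R \<or> \<one> \<ominus> x \<in> Units R"
    by (cases "x = \<zero>") (simp_all add: field_Units minus_eq)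
next
  fix I assume I: "ideal I R"
  then consider "I = {\<zero>}" | "I = carrier R" using all_ideals by blast
  then show "principalideal I R"
    using I genideal_zero genideal_one
    by cases (auto intro!: principalidealI intro: bexI[of _ \<zero>] bexI[of _ \<one>])
qed

text \<open>The additive order of \<open>\<one>\<close> divides 2 and is not 1, as a field has
  \<open>\<one>\<close> distinct from \<open>\<zero>\<close>. The contrapositive turns the condition
  on the characteristic into invertibility of 2.\<close>

lemma (in field) ring_char_2:
  assumes "\<one> \<oplus> \<one> = \<zero>"
  shows "ring_char R = 2"
proof -
  have "add.ord \<one> dvd 2"
    using add.pow_eq_id[of \<one> 2] assms by (simp add: add_pow_def numeral_2_eq_2)
  moreover have "add.ord \<one> \<noteq> 1"
    using add.ord_eq_1[of \<one>] by simp
  ultimately show ?thesis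
    using two_is_prime_nat by (auto simp: ring_char_def prime_nat_iff)
qed

theorem theorem4p6:
  fixes R :: "('a, 'b) ring_scheme" and M :: "'a set" and p :: 'a and m :: nat
  assumes "local_ring R"
    and "principal_ideal_ring R"
    and "maximalideal M R"
    and "p \<in> carrier R" and "M = PIdl\<^bsub>R\<^esub> p"
    and "adically_complete R M"
    and "ring_char (R Quot M) \<noteq> 2"
    and "m \<ge> 1"
  shows "engel_surj_sl2 R (m + 1) \<longleftrightarrow> engel_surj_sl2 (R Quot M) (m + 1)"
proof -
  interpret R: cring R using assms(1) unfolding local_ring_def by (rule conjunct1)
  interpret M: maximalideal M R by (rule assms(3))
  interpret k: field "R Quot M" by (rule M.quotient_is_field) (rule R.is_cring)
  have k2: "\<one>\<^bsub>R Quot M\<^esub> \<oplus>\<^bsub>R Quot M\<^esub> \<one>\<^bsub>R Quot M\<^esub> \<noteq> \<zero>\<^bsub>R Quot M\<^esub>"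
    using k.ring_char_2 assms(7) by (rule contrapos_nn[rotated])
  \<comment> \<open>An element of \<open>M\<close> has zero class in the quotient, whereas 2 does
    not; outside \<open>M\<close> it is a unit by locality.\<close>
  have "\<one>\<^bsub>R\<^esub> \<oplus>\<^bsub>R\<^esub> \<one>\<^bsub>R\<^esub> \<notin> M"
  proof
    assume "\<one>\<^bsub>R\<^esub> \<oplus>\<^bsub>R\<^esub> \<one>\<^bsub>R\<^esub> \<in> M"
    then have "M +>\<^bsub>R\<^esub> (\<one>\<^bsub>R\<^esub> \<oplus>\<^bsub>R\<^esub> \<one>\<^bsub>R\<^esub>) = M"
      by (simp add: R.a_coset_join2 M.a_subgroup)
    then show False
      using k2 by (simp add: FactRing_def M.a_rcos_sum)
  qed
  then have "\<one>\<^bsub>R\<^esub> \<oplus>\<^bsub>R\<^esub> \<one>\<^bsub>R\<^esub> \<in> Units R"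
    using R.local_nonunit_mem[OF assms(1,3)] by (metis R.a_closed R.one_closed)
  moreover have "local_principal_ring R"
  proof (intro local_principal_ring.intro local_principal_ring_axioms.intro R.is_cring)
    show "x \<in> Units R \<or> \<one>\<^bsub>R\<^esub> \<ominus>\<^bsub>R\<^esub> x \<in> Units R" if "x \<in> carrier R" for x
      using assms(1) that by (rule R.local_unit_or_complement)
    show "principalideal I R" if "ideal I R" for I
      using assms(2) that unfolding principal_ideal_ring_def by simp
  qed
  ultimately have "engel_surj_sl2 R (m + 1)"
    by (intro local_principal_ring.engel_surj_sl2_local_principal)
  moreover have "engel_surj_sl2 (R Quot M) (m + 1)"
    using k2 k.local_principal_ring
    by (intro local_principal_ring.engel_surj_sl2_local_principal) (simp_all add: k.field_Units)
  ultimately show ?thesis by simp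
qed

end
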